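(* Let $X$ and $E$ be Banach spaces, both of dimension at least $2$, such that $E\oplus E$ isomorphically embeds into $E$ (i.e. $E\oplus E$ is linearly isomorphic to a closed subspace of $E$). Then $X$ coarsely embeds into $E$ if and only if $$\sup_{\phi}\;\mathcal R(\phi)=\infty,$$ where the supremum is taken over all maps $\phi\colon X\to E$ and $\mathcal R(\phi)$ denotes the separation ratio of $\phi$.
   Context: A map $\phi\colon X\to E$ between Banach spaces is an arbitrary function (generally discontinuous and nonlinear). Its compression coefficient and expansion coefficient are the elements of $[0,\infty]$ given by $$\kappa(\phi)=\sup_{t<\infty}\;\inf_{\|x-y\|\geqslant t}\|\phi(x)-\phi(y)\|,\qquad \omega(\phi)=\inf_{t>0}\;\sup_{\|x-y\|\leqslant t}\|\phi(x)-\phi(y)\|,$$ where $x,y$ range over $X$. The separation ratio of $\phi$ is $$\mathcal R(\phi)=\frac{\kappa(\phi)}{\omega(\phi)}\in[0,\infty],$$ with the conventions $\frac a\infty=\frac 0a=0$ for all $a\in[0,\infty]$ (so $\frac00=\frac\infty\infty=0$) and $\frac a0=\frac\infty a=\frac\infty0=\infty$ for all $0<a<\infty$. A map $\phi\colon X\to E$ is a coarse embedding if $\omega(\phi)<\infty$ and $\kappa(\phi)=\infty$. (The condition $\omega(\phi)<\infty$ is equivalent to $\phi$ being Lipschitz for large distances, i.e. there is a constant $K$ with $\|\phi(x)-\phi(y)\|\leqslant K\|x-y\|+K$ for all $x,y\in X$.) $X$ coarsely embeds into $E$ if there exists a coarse embedding $\phi\colon X\to E$. *)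

theory Defs
  imports "HOL-Analysis.Analysis"
begin

definition compression_coeff :: "('a::real_normed_vector \<Rightarrow> 'b::real_normed_vector) \<Rightarrow> ennreal"
  where "compression_coeff \<phi> =
    (SUP t::real. INF (x, y) \<in> {(x, y). norm (x - y) \<ge> t}. ennreal (norm (\<phi> x - \<phi> y)))"

definition expansion_coeff :: "('a::real_normed_vector \<Rightarrow> 'b::real_normed_vector) \<Rightarrow> ennreal"
  where "expansion_coeff \<phi> =
    (INF t \<in> {0::real<..}. SUP (x, y) \<in> {(x, y). norm (x - y) \<le> t}. ennreal (norm (\<phi> x - \<phi> y)))"

(* Division on ennreal obeys a / \<infinity> = 0 / a = 0 for every a (so 0 / 0 = \<infinity> / \<infinity> = 0), and
   a / 0 = \<infinity> / a = \<infinity> / 0 = \<infinity> for 0 < a < \<infinity>; see separation_ratio_conventions below. *)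
definition separation_ratio :: "('a::real_normed_vector \<Rightarrow> 'b::real_normed_vector) \<Rightarrow> ennreal"
  where "separation_ratio \<phi> = compression_coeff \<phi> / expansion_coeff \<phi>"

lemma separation_ratio_conventions:
  fixes a :: ennreal
  shows "a / \<infinity> = 0" and "0 / a = 0" and "(\<infinity>::ennreal) / 0 = \<infinity>"
    and "0 < a \<Longrightarrow> a < \<infinity> \<Longrightarrow> a / 0 = \<infinity>"
    and "0 < a \<Longrightarrow> a < \<infinity> \<Longrightarrow> \<infinity> / a = \<infinity>"
  by (auto simp: ennreal_top_divide)

definition coarse_embedding :: "('a::real_normed_vector \<Rightarrow> 'b::real_normed_vector) \<Rightarrow> bool"
  where "coarse_embedding \<phi> \<longleftrightarrow> expansion_coeff \<phi> < \<infinity> \<and> compression_coeff \<phi> = \<infinity>"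

(* Continuity of T and of its inverse on the range is part of homeomorphism; the inverse
   is automatically linear. *)
definition isomorphic_embedding :: "('a::real_normed_vector \<Rightarrow> 'b::real_normed_vector) \<Rightarrow> bool"
  where "isomorphic_embedding T \<longleftrightarrow>
    linear T \<and> closed (range T) \<and> (\<exists>S. homeomorphism UNIV (range T) T S)"

(* The library's dim is 0 for infinite-dimensional spaces, so "dimension at least n" is
   expressed by an independent set of n vectors. *)
definition dim_at_least :: "'a::real_vector itself \<Rightarrow> nat \<Rightarrow> bool"
  where "dim_at_least _ n \<longleftrightarrow> (\<exists>B::'a set. independent B \<and> finite B \<and> card B = n)"

end

theory Submission
  imports Defs
begin

text \<open>
  A coarse embedding has infinite compression and finite expansion coefficient, so its
  separation ratio is \<open>\<infinity>\<close>; the content is the converse.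

  Separation ratios do not change when \<open>\<phi>\<close> is replaced by \<open>x \<mapsto> \<phi> (t x) / r\<close> with
  \<open>t, r > 0\<close>. A suitable choice of \<open>t\<close> and \<open>r\<close> therefore turns a map of separation ratio above
  \<open>N\<close> into one that moves points at distance at most \<open>1\<close> by at most \<open>1\<close>, but separates points at
  large distance by at least \<open>N\<close>
  (\<open>separation_ratio_normalize\<close>). Unbounded ratios give such a map \<open>\<psi>\<^sub>n\<close> for every prescribed
  sequence \<open>N\<^sub>n\<close>, and the maps have to be combined into a single one.

  If \<open>E\<close> were isomorphic to an infinite sum of copies of itself, one would use the \<open>\<psi>\<^sub>n\<close>, suitably
  weighted, as coordinates. An embedding \<open>T\<close> of \<open>E \<oplus> E\<close> into \<open>E\<close> is a good enough
  substitute: it can be iterated to form \<open>T (u\<^sub>0, T (u\<^sub>1, T (u\<^sub>2, \<dots>)))\<close>. If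
  \<open>c \<parallel>v\<parallel> \<le> \<parallel>T v\<parallel> \<le> C \<parallel>v\<parallel>\<close>, the coordinate \<open>u\<^sub>n\<close> enters this nested sum with norm at most
  \<open>C\<^bsup>n+1\<^esup> \<parallel>u\<^sub>n\<parallel>\<close> and is seen from outside with norm at least \<open>c\<^bsup>n+1\<^esup> \<parallel>u\<^sub>n\<parallel>\<close>
  (\<open>norm_nested_term\<close>, \<open>nested_sum_lower\<close>). Both constants may degenerate exponentially in \<open>n\<close>, but
  they are known before the maps are chosen. So take \<open>u\<^sub>n = (2 C)\<^bsup>-(n+1)\<^esup> (\<psi>\<^sub>n x - \<psi>\<^sub>n 0)\<close>:
  the weight makes the nested sum converge and keeps its expansion bounded by \<open>1\<close>, while
  \<open>N\<^sub>n = (n + 1) (2 C / c)\<^bsup>n+1\<^esup>\<close> makes the \<open>n\<close>-th coordinate alone separate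
  distant points by \<open>n\<close>. This is \<open>coarse_embedding_from_ratios\<close>.
\<close>

section \<open>Quantitative form of the coefficients\<close>

lemma expansion_coeff_lessE:
  fixes \<phi> :: "'a::real_normed_vector \<Rightarrow> 'b::real_normed_vector"
  assumes "expansion_coeff \<phi> < ennreal r"
  obtains t where "0 < t" "\<And>x y. norm (x - y) \<le> t \<Longrightarrow> norm (\<phi> x - \<phi> y) < r"
proof -
  obtain t where t: "0 < t"
    and sup: "(SUP (x, y) \<in> {(x, y). norm (x - y) \<le> t}. ennreal (norm (\<phi> x - \<phi> y))) < ennreal r"
    using assms unfolding expansion_coeff_def by (auto simp: INF_less_iff)
  have "norm (\<phi> x - \<phi> y) < r" if "norm (x - y) \<le> t" for x y
  proof -
    have "ennreal (norm (\<phi> x - \<phi> y))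
        \<le> (SUP (x, y) \<in> {(x, y). norm (x - y) \<le> t}. ennreal (norm (\<phi> x - \<phi> y)))"
      by (rule SUP_upper2[where i = "(x, y)"]) (use that in auto)
    with sup have "ennreal (norm (\<phi> x - \<phi> y)) < ennreal r"
      by (rule order.strict_trans1[rotated])
    then show ?thesis
      by (simp add: ennreal_less_iff)
  qed
  with t show ?thesis
    using that by blast
qed

lemma less_compression_coeffE:
  fixes \<phi> :: "'a::real_normed_vector \<Rightarrow> 'b::real_normed_vector"
  assumes "ennreal r < compression_coeff \<phi>"
  obtains s where "\<And>x y. s \<le> norm (x - y) \<Longrightarrow> r \<le> norm (\<phi> x - \<phi> y)"
proof -
  obtain s
    where inf: "ennreal r < (INF (x, y) \<in> {(x, y). s \<le> norm (x - y)}. ennreal (norm (\<phi> x - \<phi> y)))"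
    using assms unfolding compression_coeff_def by (auto simp: less_SUP_iff)
  have "r \<le> norm (\<phi> x - \<phi> y)" if "s \<le> norm (x - y)" for x y
  proof -
    have "(INF (x, y) \<in> {(x, y). s \<le> norm (x - y)}. ennreal (norm (\<phi> x - \<phi> y)))
        \<le> ennreal (norm (\<phi> x - \<phi> y))"
      by (rule INF_lower2[where i = "(x, y)"]) (use that in auto)
    with inf have "ennreal r < ennreal (norm (\<phi> x - \<phi> y))"
      by (rule order.strict_trans2)
    then show ?thesis
      by (metis ennreal_leI leD linorder_le_cases)
  qed
  then show ?thesis
    using that by blast
qed

lemma coarse_embeddingI:
  fixes \<phi> :: "'a::real_normed_vector \<Rightarrow> 'b::real_normed_vector"
  assumes upper: "\<And>x y. norm (x - y) \<le> 1 \<Longrightarrow> norm (\<phi> x - \<phi> y) \<le> K"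
    and lower: "\<And>n::nat. \<exists>s. \<forall>x y. s \<le> norm (x - y) \<longrightarrow> real n \<le> norm (\<phi> x - \<phi> y)"
  shows "coarse_embedding \<phi>"
  unfolding coarse_embedding_def
proof
  have "expansion_coeff \<phi> \<le> ennreal K"
    unfolding expansion_coeff_def
    by (rule INF_lower2[where i = 1]) (auto intro!: SUP_least ennreal_leI upper)
  then show "expansion_coeff \<phi> < \<infinity>"
    by (simp add: le_less_trans)
  have "of_nat n \<le> compression_coeff \<phi>" for n
  proof -
    obtain s where s: "\<And>x y. s \<le> norm (x - y) \<Longrightarrow> real n \<le> norm (\<phi> x - \<phi> y)"
      using lower by blast
    have "ennreal (real n) \<le> compression_coeff \<phi>"
      unfolding compression_coeff_def
      by (rule SUP_upper2[where i = s]) (auto intro!: INF_greatest ennreal_leI s)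
    then show ?thesis
      by (simp add: ennreal_of_nat_eq_real_of_nat)
  qed
  then show "compression_coeff \<phi> = \<infinity>"
    by (metis ennreal_Ex_less_of_nat infinity_ennreal_def leD top.not_eq_extremum)
qed

text \<open>
  The convention \<open>0 / 0 = 0\<close> makes this hold also for \<open>b = 0\<close>, as it forces \<open>a > 0\<close>; so maps with vanishing
  expansion coefficient need no separate treatment below.
\<close>

lemma ennreal_less_divide_swap:
  fixes a b n :: ennreal
  assumes "0 < n" "n < \<infinity>" "n < a / b"
  shows "b < a / n"
proof (rule ccontr)
  assume "\<not> b < a / n"
  then have "a / n * n \<le> b * n"
    by (intro mult_right_mono) auto
  moreover have "a / n * n = a"
    using assms(1,2) by (simp add: ennreal_divide_times ennreal_mult_divide_eq)
  ultimately have "a / b \<le> b * n / b"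
    by (simp add: divide_right_mono_ennreal)
  also have "\<dots> \<le> n"
    by (cases "b = 0 \<or> b = \<infinity>") (auto simp: mult.commute[of b] ennreal_mult_divide_eq)
  finally show False
    using assms(3) by simp
qed

text \<open>
  The swapped inequality leaves room for a real \<open>r\<close> with \<open>\<omega>(\<phi>) < r\<close> and \<open>N r < \<kappa>(\<phi>)\<close>. Dividing the
  values of \<open>\<phi>\<close> by \<open>r\<close>, and dilating the domain so that the scale on which \<open>\<phi>\<close> moves points by less
  than \<open>r\<close> becomes \<open>1\<close>, gives \<open>\<psi>\<close>.
\<close>

lemma separation_ratio_normalize:
  fixes \<phi> :: "'a::real_normed_vector \<Rightarrow> 'b::real_normed_vector"
  assumes "0 < N" and ratio: "ennreal N < separation_ratio \<phi>"
  shows "\<exists>(\<psi> :: 'a \<Rightarrow> 'b) s.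
    (\<forall>x y. norm (x - y) \<le> 1 \<longrightarrow> norm (\<psi> x - \<psi> y) \<le> 1) \<and>
    (\<forall>x y. s \<le> norm (x - y) \<longrightarrow> N \<le> norm (\<psi> x - \<psi> y))"
proof -
  have "expansion_coeff \<phi> < compression_coeff \<phi> / ennreal N"
    by (rule ennreal_less_divide_swap[OF _ _ ratio[unfolded separation_ratio_def]])
      (use \<open>0 < N\<close> in auto)
  then obtain r' where r': "expansion_coeff \<phi> < r'" "r' < compression_coeff \<phi> / ennreal N"
    using dense by blast
  then obtain r where r: "r' = ennreal r" "0 \<le> r"
    by (cases r') auto
  have "0 < r"
    using le_less_trans[OF zero_le r'(1)] r by simp
  obtain t where t: "0 < t" "\<And>x y. norm (x - y) \<le> t \<Longrightarrow> norm (\<phi> x - \<phi> y) < r"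
    using expansion_coeff_lessE r'(1) r(1) by metis
  have "ennreal (N * r) < compression_coeff \<phi>"
    using r'(2) r \<open>0 < N\<close>
    by (metis divide_ennreal divide_right_mono_ennreal leD leI less_le_not_le
        nonzero_mult_div_cancel_left split_mult_pos_le)
  then obtain s where s: "\<And>x y. s \<le> norm (x - y) \<Longrightarrow> N * r \<le> norm (\<phi> x - \<phi> y)"
    using less_compression_coeffE by blast
  define \<psi> where "\<psi> x = (1 / r) *\<^sub>R \<phi> (t *\<^sub>R x)" for x
  have \<psi>: "norm (\<psi> x - \<psi> y) = norm (\<phi> (t *\<^sub>R x) - \<phi> (t *\<^sub>R y)) / r" for x y
    using \<open>0 < r\<close> by (simp add: \<psi>_def flip: scaleR_right_diff_distrib)
  have dist: "norm (t *\<^sub>R x - t *\<^sub>R y) = t * norm (x - y)" for x y :: 'a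
    using \<open>0 < t\<close> by (simp flip: scaleR_right_diff_distrib)
  show ?thesis
  proof (intro exI[of _ \<psi>] exI[of _ "s / t"] conjI allI impI)
    show "norm (\<psi> x - \<psi> y) \<le> 1" if "norm (x - y) \<le> 1" for x y
      using that t(2)[of "t *\<^sub>R x" "t *\<^sub>R y"] \<open>0 < r\<close> \<open>0 < t\<close> by (simp add: \<psi> dist)
    show "N \<le> norm (\<psi> x - \<psi> y)" if "s / t \<le> norm (x - y)" for x y
      using that s[of "t *\<^sub>R x" "t *\<^sub>R y"] \<open>0 < r\<close> \<open>0 < t\<close>
      by (simp add: \<psi> dist pos_le_divide_eq pos_divide_le_eq mult.commute)
  qed
qed

text \<open>
  The segment from \<open>0\<close> to \<open>x\<close> splits into \<open>n\<close> steps of length at most \<open>1\<close>. The bound does not depend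
  on \<open>\<psi>\<close>, which later makes a whole sequence of such maps bounded at each point.
\<close>

lemma norm_diff_le_of_unit_scale:
  fixes \<psi> :: "'a::real_normed_vector \<Rightarrow> 'b::real_normed_vector"
  assumes "\<And>x y. norm (x - y) \<le> 1 \<Longrightarrow> norm (\<psi> x - \<psi> y) \<le> 1"
  shows "norm x \<le> real n \<Longrightarrow> norm (\<psi> x - \<psi> 0) \<le> real n"
proof (induction n arbitrary: x)
  case (Suc n)
  define z where "z = (real n / real (Suc n)) *\<^sub>R x"
  have "norm z = real n / real (Suc n) * norm x"
    by (simp add: z_def)
  also have "\<dots> \<le> real n / real (Suc n) * real (Suc n)"
    using Suc.prems by (intro mult_left_mono) auto
  finally have "norm z \<le> real n"
    by simp
  have "x - z = (1 - real n / real (Suc n)) *\<^sub>R x"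
    by (simp add: z_def scaleR_left_diff_distrib)
  also have "1 - real n / real (Suc n) = 1 / real (Suc n)"
    by (simp add: field_simps)
  finally have "norm (x - z) = norm x / real (Suc n)"
    by simp
  also have "\<dots> \<le> 1"
    using Suc.prems by simp
  finally have "norm (x - z) \<le> 1" .
  then have "norm (\<psi> x - \<psi> z) \<le> 1"
    by (rule assms)
  moreover have "norm (\<psi> z - \<psi> 0) \<le> real n"
    using \<open>norm z \<le> real n\<close> by (rule Suc.IH)
  ultimately show ?case
    using norm_triangle_ineq[of "\<psi> x - \<psi> z" "\<psi> z - \<psi> 0"] by simp
qed simp

section \<open>Nested sums in a space containing its square\<close>

lemma isomorphic_embedding_bounds:
  fixes T :: "'a::real_normed_vector \<Rightarrow> 'b::real_normed_vector"
  assumes "isomorphic_embedding T"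
  shows "\<exists>c C. 0 < c \<and> 0 < C \<and>
    (\<forall>v. c * norm v \<le> norm (T v)) \<and> (\<forall>v. norm (T v) \<le> C * norm v)"
proof -
  from assms obtain S where lin: "linear T" and hom: "homeomorphism UNIV (range T) T S"
    by (auto simp: isomorphic_embedding_def)
  have T0: "T 0 = 0"
    using lin by (rule linear_0)
  have S: "S (T v) = v" for v
    using hom by (simp add: homeomorphism_def)
  \<comment> \<open>Both bounds come from continuity at \<open>0\<close>, of \<open>S\<close> and of \<open>T\<close>, rescaled to vectors of norm \<open>1\<close>.\<close>
  have unit: "norm (T v) = norm v * norm (T ((1 / norm v) *\<^sub>R v))" if "v \<noteq> 0" for v
    using that by (simp add: linear_cmul[OF lin])
  have "continuous_on UNIV T"
    using hom by (simp add: homeomorphism_def)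
  then obtain d where d: "0 < d" "\<And>v. norm v < d \<Longrightarrow> norm (T v) < 1"
    unfolding continuous_on_iff
    by (metis T0 UNIV_I diff_zero dist_norm zero_less_one)
  have "continuous_on (range T) S"
    using hom by (simp add: homeomorphism_def)
  then obtain c where c: "0 < c" "\<And>v. norm (T v) < c \<Longrightarrow> norm v < 1"
    unfolding continuous_on_iff
    by (metis S T0 diff_zero dist_norm rangeI zero_less_one)
  show ?thesis
  proof (rule exI[of _ c], rule exI[of _ "2 / d"], intro conjI allI)
    show "0 < c" "0 < 2 / d"
      using c d by auto
    show "c * norm v \<le> norm (T v)" for v
    proof (cases "v = 0")
      case False
      then have "\<not> norm ((1 / norm v) *\<^sub>R v) < 1"
        by simp
      then have "c \<le> norm (T ((1 / norm v) *\<^sub>R v))"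
        using c(2) not_less by blast
      then show ?thesis
        using mult_left_mono[of c "norm (T ((1 / norm v) *\<^sub>R v))" "norm v"] unit[OF False]
        by (simp add: mult.commute)
    qed simp
    show "norm (T v) \<le> 2 / d * norm v" for v
    proof (cases "v = 0")
      case False
      have "norm (T ((d / 2) *\<^sub>R (1 / norm v) *\<^sub>R v)) < 1"
        using d(1) False by (intro d(2)) simp
      then have "d / 2 * norm (T ((1 / norm v) *\<^sub>R v)) \<le> 1"
        using d(1) by (simp add: linear_cmul[OF lin])
      then have "norm (T ((1 / norm v) *\<^sub>R v)) \<le> 2 / d"
        using d(1) by (simp add: field_simps)
      then show ?thesis
        using mult_left_mono[of "norm (T ((1 / norm v) *\<^sub>R v))" "2 / d" "norm v"] unit[OF False]
        by (simp add: mult.commute)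
    qed (simp add: T0)
  qed
qed

locale square_embedding =
  fixes T :: "'e::banach \<times> 'e \<Rightarrow> 'e" and c C :: real
  assumes linear: "linear T"
    and c_pos: "0 < c" and C_pos: "0 < C"
    and lower: "c * norm v \<le> norm (T v)"
    and upper: "norm (T v) \<le> C * norm v"
begin

definition tail :: "'e \<Rightarrow> 'e"
  where "tail v = T (0, v)"

text \<open>
  This series is the value of \<open>T (u 0, T (u 1, T (u 2, \<dots>)))\<close>, expanded by linearity of \<open>T\<close>;
  see \<open>nested_sum_unfold\<close>.
\<close>

definition nested_sum :: "(nat \<Rightarrow> 'e) \<Rightarrow> 'e"
  where "nested_sum u = (\<Sum>k. (tail ^^ k) (T (u k, 0)))"

text \<open>The weights are those of \<open>norm_nested_term\<close>, so the series converges absolutely.\<close>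

definition admissible :: "(nat \<Rightarrow> 'e) \<Rightarrow> bool"
  where "admissible u \<longleftrightarrow> summable (\<lambda>k. C ^ Suc k * norm (u k))"

lemma bounded_linear_tail: "bounded_linear tail"
proof (rule bounded_linear_intro)
  show "tail (x + y) = tail x + tail y" for x y
    using linear_add[OF linear, of "(0, x)" "(0, y)"] by (simp add: tail_def)
  show "tail (r *\<^sub>R x) = r *\<^sub>R tail x" for r x
    using linear_cmul[OF linear, of r "(0, x)"] by (simp add: tail_def)
  show "norm (tail x) \<le> norm x * C" for x
    using upper[of "(0, x)"] by (simp add: tail_def norm_Pair mult.commute)
qed

lemma norm_tail_power: "norm ((tail ^^ k) v) \<le> C ^ k * norm v"
proof (induction k)
  case (Suc k)
  have "norm (tail ((tail ^^ k) v)) \<le> C * norm ((tail ^^ k) v)"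
    using upper[of "(0, (tail ^^ k) v)"] by (simp add: tail_def norm_Pair)
  also have "\<dots> \<le> C * (C ^ k * norm v)"
    using Suc C_pos by simp
  finally show ?case
    by (simp add: mult.assoc)
qed simp

lemma norm_nested_term: "norm ((tail ^^ k) (T (u, 0))) \<le> C ^ Suc k * norm u"
proof -
  have "norm ((tail ^^ k) (T (u, 0))) \<le> C ^ k * norm (T (u, 0))"
    by (rule norm_tail_power)
  also have "\<dots> \<le> C ^ k * (C * norm u)"
    using upper[of "(u, 0)"] C_pos by (intro mult_left_mono) (auto simp: norm_Pair)
  finally show ?thesis
    by (simp add: mult.assoc mult.left_commute)
qed

lemma summable_nested: "admissible u \<Longrightarrow> summable (\<lambda>k. (tail ^^ k) (T (u k, 0)))"
  unfolding admissible_def by (rule summable_comparison_test'[OF _ norm_nested_term])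

lemma admissible_Suc:
  assumes "admissible u"
  shows "admissible (\<lambda>k. u (Suc k))"
proof -
  have "summable (\<lambda>k. C ^ Suc (Suc k) * norm (u (Suc k)))"
    using assms unfolding admissible_def by (subst summable_Suc_iff)
  then have "summable (\<lambda>k. C * (C ^ Suc k * norm (u (Suc k))))"
    by (simp add: mult.assoc)
  then show ?thesis
    unfolding admissible_def using C_pos by (subst (asm) summable_cmult_iff) auto
qed

lemma admissible_diff:
  assumes "admissible u" "admissible v"
  shows "admissible (\<lambda>k. u k - v k)"
  unfolding admissible_def
proof (rule summable_comparison_test')
  show "summable (\<lambda>k. C ^ Suc k * norm (u k) + C ^ Suc k * norm (v k))"
    using assms unfolding admissible_def by (rule summable_add)
  show "norm (C ^ Suc k * norm (u k - v k)) \<le> C ^ Suc k * norm (u k) + C ^ Suc k * norm (v k)" for k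
    using mult_left_mono[OF norm_triangle_ineq4[of "u k" "v k"], of "C ^ Suc k"] C_pos
    by (simp add: distrib_left)
qed

lemma nested_sum_diff:
  assumes "admissible u" "admissible v"
  shows "nested_sum u - nested_sum v = nested_sum (\<lambda>k. u k - v k)"
proof -
  have "(tail ^^ k) (T (a, 0)) - (tail ^^ k) (T (b, 0)) = (tail ^^ k) (T (a - b, 0))" for a b k
  proof (induction k)
    case 0
    show ?case
      using linear_diff[OF linear, of "(a, 0)" "(b, 0)"] by simp
  next
    case (Suc k)
    then show ?case
      by (simp flip: linear_diff[OF bounded_linear.linear[OF bounded_linear_tail]])
  qed
  then show ?thesis
    using suminf_diff[OF summable_nested[OF assms(1)] summable_nested[OF assms(2)]]
    by (simp add: nested_sum_def)
qed

lemma nested_sum_unfold: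
  assumes "admissible u"
  shows "nested_sum u = T (u 0, nested_sum (\<lambda>k. u (Suc k)))"
proof -
  have "nested_sum u = T (u 0, 0) + (\<Sum>k. (tail ^^ Suc k) (T (u (Suc k), 0)))"
    using suminf_split_head[OF summable_nested[OF assms]] by (simp add: nested_sum_def)
  also have "(\<Sum>k. (tail ^^ Suc k) (T (u (Suc k), 0))) = tail (nested_sum (\<lambda>k. u (Suc k)))"
    using bounded_linear.suminf[OF bounded_linear_tail summable_nested[OF admissible_Suc[OF assms]]]
    by (simp add: nested_sum_def)
  finally show ?thesis
    using linear_add[OF linear, of "(u 0, 0)" "(0, nested_sum (\<lambda>k. u (Suc k)))"]
    by (simp add: tail_def)
qed

text \<open>
  By the unfolding equation \<open>u n\<close> lies below \<open>n + 1\<close> applications of \<open>T\<close>. Each of them is bounded below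
  by \<open>c\<close>, and the norm of a pair dominates the norms of its components; hence the other terms
  cannot cancel \<open>u n\<close>.
\<close>

lemma nested_sum_lower:
  "admissible u \<Longrightarrow> c ^ Suc n * norm (u n) \<le> norm (nested_sum u)"
proof (induction n arbitrary: u)
  case 0
  have "c * norm (u 0) \<le> c * norm (u 0, nested_sum (\<lambda>k. u (Suc k)))"
    using c_pos norm_fst_le[of "u 0" "nested_sum (\<lambda>k. u (Suc k))"] by simp
  also have "\<dots> \<le> norm (nested_sum u)"
    unfolding nested_sum_unfold[OF 0] by (rule lower)
  finally show ?case
    by simp
next
  case (Suc n)
  let ?w = "nested_sum (\<lambda>k. u (Suc k))"
  have "c ^ Suc (Suc n) * norm (u (Suc n)) = c * (c ^ Suc n * norm (u (Suc n)))"
    by simp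
  also have "\<dots> \<le> c * norm ?w"
    using Suc.IH[OF admissible_Suc[OF Suc.prems]] c_pos by (intro mult_left_mono) auto
  also have "\<dots> \<le> c * norm (u 0, ?w)"
    using c_pos norm_snd_le[where x = "u 0" and y = ?w] by (intro mult_left_mono) auto
  also have "\<dots> \<le> norm (nested_sum u)"
    unfolding nested_sum_unfold[OF Suc.prems] by (rule lower)
  finally show ?case .
qed

lemma geometric_admissible:
  assumes "\<And>k. C ^ Suc k * norm (u k) \<le> K * (1 / 2) ^ Suc k"
  shows "admissible u" "norm (nested_sum u) \<le> K"
proof -
  have sums: "(\<lambda>k. K * (1 / 2) ^ Suc k) sums (K * 1)"
    by (intro sums_mult power_half_series)
  show "admissible u"
    unfolding admissible_def
    by (rule summable_comparison_test'[OF sums_summable[OF sums]]) (use assms C_pos in auto)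
  have "norm ((tail ^^ k) (T (u k, 0))) \<le> K * (1 / 2) ^ Suc k" for k
    using norm_nested_term assms by (rule order_trans)
  then have "norm (nested_sum u) \<le> (\<Sum>k. K * (1 / 2) ^ Suc k)"
    unfolding nested_sum_def by (rule norm_suminf_le) (rule sums_summable[OF sums])
  then show "norm (nested_sum u) \<le> K"
    using sums_unique[OF sums] by simp
qed

text \<open>
  The weights \<open>w n\<close> depend on \<open>C\<close> only and the thresholds \<open>N n\<close> on \<open>c\<close> and \<open>w n\<close>, so the maps \<open>\<psi> n\<close>
  can be chosen after all losses of the nested sum are known.
\<close>

lemma coarse_embedding_from_ratios:
  assumes "\<And>N. 0 < N \<Longrightarrow> \<exists>\<phi> :: 'x::real_normed_vector \<Rightarrow> 'e. ennreal N < separation_ratio \<phi>"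
  shows "\<exists>\<Phi> :: 'x \<Rightarrow> 'e. coarse_embedding \<Phi>"
proof -
  define w where "w n = (1 / (2 * C)) ^ Suc n" for n :: nat
  have w_pos: "0 < w n" for n
    using C_pos by (simp add: w_def)
  have Cw: "C ^ Suc n * w n = (1 / 2) ^ Suc n" for n
    unfolding w_def power_mult_distrib[symmetric] using C_pos by simp
  define N where "N n = (real n + 1) / (c ^ Suc n * w n)" for n
  have N_pos: "0 < N n" for n
    using c_pos w_pos[of n] by (simp add: N_def)
  have "\<exists>(\<psi> :: 'x \<Rightarrow> 'e) s. (\<forall>x y. norm (x - y) \<le> 1 \<longrightarrow> norm (\<psi> x - \<psi> y) \<le> 1) \<and>
      (\<forall>x y. s \<le> norm (x - y) \<longrightarrow> N n \<le> norm (\<psi> x - \<psi> y))" for n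
  proof -
    obtain \<phi> :: "'x \<Rightarrow> 'e" where "ennreal (N n) < separation_ratio \<phi>"
      using assms N_pos by blast
    with N_pos show ?thesis
      by (rule separation_ratio_normalize)
  qed
  then obtain \<psi> :: "nat \<Rightarrow> 'x \<Rightarrow> 'e" and s where
    \<psi>_upper: "\<And>n x y. norm (x - y) \<le> 1 \<Longrightarrow> norm (\<psi> n x - \<psi> n y) \<le> 1" and
    \<psi>_lower: "\<And>n x y. s n \<le> norm (x - y) \<Longrightarrow> N n \<le> norm (\<psi> n x - \<psi> n y)"
    by metis
  \<comment> \<open>Subtracting \<open>\<psi> n 0\<close> makes the coordinates of each \<open>x\<close> bounded in \<open>n\<close>, since only differences of
    values are controlled.\<close>
  define u where "u x n = w n *\<^sub>R (\<psi> n x - \<psi> n 0)" for x n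
  define \<Phi> where "\<Phi> x = nested_sum (u x)" for x
  have weight: "C ^ Suc n * norm (w n *\<^sub>R v) \<le> K * (1 / 2) ^ Suc n" if "norm v \<le> K" for n v K
  proof -
    have "C ^ Suc n * norm (w n *\<^sub>R v) = (1 / 2) ^ Suc n * norm v"
      unfolding Cw[symmetric] using w_pos[of n] by simp
    also have "\<dots> \<le> (1 / 2) ^ Suc n * K"
      using that by (intro mult_left_mono) auto
    finally show ?thesis
      by (simp only: mult.commute)
  qed
  have adm: "admissible (u x)" for x
  proof -
    obtain m :: nat where "norm x \<le> real m"
      using real_arch_simple by blast
    then have "norm (\<psi> n x - \<psi> n 0) \<le> real m" for n
      using norm_diff_le_of_unit_scale \<psi>_upper by blast
    then show ?thesis
      unfolding u_def by (intro geometric_admissible(1) weight)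
  qed
  have u_diff: "u x n - u y n = w n *\<^sub>R (\<psi> n x - \<psi> n y)" for x y n
    by (simp add: u_def algebra_simps)
  have \<Phi>_diff: "\<Phi> x - \<Phi> y = nested_sum (\<lambda>n. w n *\<^sub>R (\<psi> n x - \<psi> n y))" for x y
    using nested_sum_diff[OF adm adm, of x y] by (simp add: \<Phi>_def u_diff)
  have adm_diff: "admissible (\<lambda>n. w n *\<^sub>R (\<psi> n x - \<psi> n y))" for x y
    using admissible_diff[OF adm adm, of x y] by (simp add: u_diff)
  have "coarse_embedding \<Phi>"
  proof (rule coarse_embeddingI)
    show "norm (\<Phi> x - \<Phi> y) \<le> 1" if "norm (x - y) \<le> 1" for x y
      unfolding \<Phi>_diff using that by (intro geometric_admissible(2) weight \<psi>_upper)
    show "\<exists>s. \<forall>x y. s \<le> norm (x - y) \<longrightarrow> real n \<le> norm (\<Phi> x - \<Phi> y)" for n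
    proof (intro exI[of _ "s n"] allI impI)
      fix x y :: 'x
      assume "s n \<le> norm (x - y)"
      then have "N n \<le> norm (\<psi> n x - \<psi> n y)"
        by (rule \<psi>_lower)
      then have "c ^ Suc n * w n * N n \<le> c ^ Suc n * w n * norm (\<psi> n x - \<psi> n y)"
        using c_pos w_pos[of n] by (intro mult_left_mono) auto
      moreover have "c ^ Suc n * w n * N n = real n + 1"
        using c_pos w_pos[of n] by (simp add: N_def)
      ultimately have "real n \<le> c ^ Suc n * norm (w n *\<^sub>R (\<psi> n x - \<psi> n y))"
        using w_pos[of n] by (simp add: mult.assoc)
      also have "\<dots> \<le> norm (\<Phi> x - \<Phi> y)"
        unfolding \<Phi>_diff by (rule nested_sum_lower[OF adm_diff])
      finally show "real n \<le> norm (\<Phi> x - \<Phi> y)" .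
    qed
  qed
  then show ?thesis
    by blast
qed

end

section \<open>Separation ratios and coarse embeddability\<close>

theorem theorem3:
  assumes "dim_at_least TYPE('x::banach) 2"
    and "dim_at_least TYPE('e::banach) 2"
    and "\<exists>T :: 'e \<times> 'e \<Rightarrow> 'e. isomorphic_embedding T"
  shows "(\<exists>\<phi> :: 'x \<Rightarrow> 'e. coarse_embedding \<phi>) \<longleftrightarrow>
    (SUP \<phi> :: 'x \<Rightarrow> 'e. separation_ratio \<phi>) = \<infinity>"
proof
  assume "\<exists>\<phi> :: 'x \<Rightarrow> 'e. coarse_embedding \<phi>"
  then obtain \<phi> :: "'x \<Rightarrow> 'e" where "expansion_coeff \<phi> < \<infinity>" "compression_coeff \<phi> = \<infinity>"
    by (auto simp: coarse_embedding_def)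
  then have "separation_ratio \<phi> = \<infinity>"
    by (simp add: separation_ratio_def ennreal_top_divide)
  then show "(SUP \<phi> :: 'x \<Rightarrow> 'e. separation_ratio \<phi>) = \<infinity>"
    by (metis SUP_upper UNIV_I infinity_ennreal_def top.extremum_uniqueI)
next
  assume sup: "(SUP \<phi> :: 'x \<Rightarrow> 'e. separation_ratio \<phi>) = \<infinity>"
  obtain T :: "'e \<times> 'e \<Rightarrow> 'e" where T: "isomorphic_embedding T"
    using assms(3) by blast
  then obtain c C where "0 < c" "0 < C"
    "\<And>v. c * norm v \<le> norm (T v)" "\<And>v. norm (T v) \<le> C * norm v"
    using isomorphic_embedding_bounds by blast
  then interpret square_embedding T c C
    using T unfolding square_embedding_def isomorphic_embedding_def by blast
  show "\<exists>\<phi> :: 'x \<Rightarrow> 'e. coarse_embedding \<phi>"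
  proof (rule coarse_embedding_from_ratios)
    fix N :: real
    have "ennreal N < (SUP \<phi> :: 'x \<Rightarrow> 'e. separation_ratio \<phi>)"
      by (simp add: sup)
    then show "\<exists>\<phi> :: 'x \<Rightarrow> 'e. ennreal N < separation_ratio \<phi>"
      by (simp add: less_SUP_iff)
  qed
qed

end
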